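(* Let $\mathbf{x}^{(1)},\mathbf{x}^{(2)},\mathbf{x}^{(3)}\in\mathbb{R}^2$, and let initial data $\mathbf{a}_0\in\mathbb{R}^2$, $\boldsymbol{\alpha}_0\in\mathbb{R}^3$ and $T>0$ be given. Let $(\boldsymbol{\alpha}_1,\mathbf{a}_1)$ and $(\boldsymbol{\alpha}_2,\mathbf{a}_2)$ be classical solutions on $0\le t\le T$ of the initial value problem (S) described in the context, both with initial data $(\boldsymbol{\alpha}_0,\mathbf{a}_0)$, and put $\mathbf{b}_k^{(j)}(t)=\mathbf{x}^{(j)}-\mathbf{a}_k(t)$. Assume that there exists a constant $c>0$ such that $|\mathbf{b}_k^{(j)}(t)|\ge c$ for $0\le t\le T$, $j=1,2,3$ and $k=1,2$. Then $(\boldsymbol{\alpha}_1(t),\mathbf{a}_1(t))=(\boldsymbol{\alpha}_2(t),\mathbf{a}_2(t))$ for all $0\le t\le T$; that is, the classical solution on $[0,T]$ is unique.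
   Context: The surface tension $\sigma:\mathbb{R}\to[0,\infty)$ is continuously differentiable with locally Lipschitz derivative $\sigma_\theta=\sigma'$, and satisfies: (i) there is a constant $C_1>0$ with $\sigma(\theta)\ge C_1$ for all $\theta\in\mathbb{R}$; (ii) $\sigma_\theta(\theta)\theta\ge0$ for all $\theta$; (iii) $\sigma_\theta(\theta)=0$ if and only if $\theta=0$. $|\cdot|$ is the Euclidean norm. Superscripts are cyclic modulo 3: $\alpha^{(0)}=\alpha^{(3)}$, $\alpha^{(4)}=\alpha^{(1)}$, etc. The misorientations are $\Delta\alpha^{(j)}=\alpha^{(j-1)}-\alpha^{(j)}$. Problem (S): find $\boldsymbol{\alpha}(t)=(\alpha^{(1)}(t),\alpha^{(2)}(t),\alpha^{(3)}(t))\in\mathbb{R}^3$ and $\mathbf{a}(t)\in\mathbb{R}^2$ such that, with $\mathbf{b}^{(j)}(t)=\mathbf{x}^{(j)}-\mathbf{a}(t)$ (nonzero for all times considered), $$\frac{d\alpha^{(j)}}{dt}=-\Big(\sigma_\theta(\Delta\alpha^{(j+1)})|\mathbf{b}^{(j+1)}|-\sigma_\theta(\Delta\alpha^{(j)})|\mathbf{b}^{(j)}|\Big),\ j=1,2,3,\qquad \frac{d\mathbf{a}}{dt}=\sum_{j=1}^3\sigma(\Delta\alpha^{(j)})\frac{\mathbf{b}^{(j)}}{|\mathbf{b}^{(j)}|},$$ with prescribed initial values $\boldsymbol{\alpha}(0)$, $\mathbf{a}(0)$. A classical solution is a continuously differentiable pair satisfying these equations. *)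

theory Defs
  imports "HOL-Analysis.Analysis"
begin

text \<open>
  Superscripts \<open>j = 1, 2, 3\<close> live in the numeral type \<open>3\<close>, whose arithmetic is modulo 3, so
  \<open>j + 1\<close> and \<open>j - 1\<close> are already cyclic:
\<close>

lemma cyclic_superscripts: "(3::3) + 1 = 1" "(1::3) - 1 = 3"
  by simp_all

text \<open>
  The library's \<^const>\<open>local_lipschitz\<close> is stated for families of functions; here the family is
  constant in its (dummy) parameter.
\<close>

definition surface_tension :: "(real \<Rightarrow> real) \<Rightarrow> bool" where
  "surface_tension \<sigma> \<longleftrightarrow>
     (\<forall>\<theta>. 0 \<le> \<sigma> \<theta>) \<and>
     \<sigma> C1_differentiable_on UNIV \<and>
     local_lipschitz (UNIV::real set) UNIV (\<lambda>_. deriv \<sigma>) \<and>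
     (\<exists>C\<^sub>1>0. \<forall>\<theta>. C\<^sub>1 \<le> \<sigma> \<theta>) \<and>
     (\<forall>\<theta>. 0 \<le> deriv \<sigma> \<theta> * \<theta>) \<and>
     (\<forall>\<theta>. deriv \<sigma> \<theta> = 0 \<longleftrightarrow> \<theta> = 0)"

definition misorientation :: "real^3 \<Rightarrow> 3 \<Rightarrow> real" where
  "misorientation \<alpha> j = \<alpha> $ (j - 1) - \<alpha> $ j"

text \<open>
  Derivatives are taken within \<open>S\<close>, hence one-sided at the end points of a closed interval; the
  library's \<^const>\<open>C1_differentiable_on\<close> would ask for two-sided derivatives there.
\<close>

definition C1_within :: "(real \<Rightarrow> 'a::real_normed_vector) \<Rightarrow> real set \<Rightarrow> bool" where
  "C1_within f S \<longleftrightarrow>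
     (\<exists>f'. continuous_on S f' \<and> (\<forall>t\<in>S. (f has_vector_derivative f' t) (at t within S)))"

definition classical_solution ::
  "(real \<Rightarrow> real) \<Rightarrow> (3 \<Rightarrow> real^2) \<Rightarrow> real^3 \<Rightarrow> real^2 \<Rightarrow> real
     \<Rightarrow> (real \<Rightarrow> real^3) \<Rightarrow> (real \<Rightarrow> real^2) \<Rightarrow> bool" where
  "classical_solution \<sigma> x \<alpha>\<^sub>0 a\<^sub>0 T \<alpha> a \<longleftrightarrow>
     C1_within \<alpha> {0..T} \<and> C1_within a {0..T} \<and>
     \<alpha> 0 = \<alpha>\<^sub>0 \<and> a 0 = a\<^sub>0 \<and>
     (\<forall>t\<in>{0..T}.
        let b = (\<lambda>j. x j - a t); \<Delta> = misorientation (\<alpha> t) in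
          (\<forall>j. b j \<noteq> 0) \<and>
          (\<forall>j. ((\<lambda>s. \<alpha> s $ j) has_real_derivative
                  - (deriv \<sigma> (\<Delta> (j + 1)) * norm (b (j + 1)) - deriv \<sigma> (\<Delta> j) * norm (b j)))
                (at t within {0..T})) \<and>
          (a has_vector_derivative (\<Sum>j\<in>UNIV. \<sigma> (\<Delta> j) *\<^sub>R (b j /\<^sub>R norm (b j))))
            (at t within {0..T}))"

end

theory Submission
  imports Defs
begin

text \<open>
  The pair \<open>(\<alpha>, a)\<close> solves an autonomous ODE. The ranges of both solutions lie in a compact set on
  which all \<open>\<bar>b\<^bsup>(j)\<^esup>\<bar>\<close> are bounded away from \<open>0\<close>; there the right-hand side is a combination of
  products and composites of bounded Lipschitz functions, hence Lipschitz with some constant \<open>L\<close>.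
  So the squared distance \<open>D\<close> of the solutions satisfies \<open>D' \<le> 2LD\<close>, and \<open>e\<^bsup>-2Lt\<^esup> D(t)\<close> is
  nonincreasing, nonnegative and \<open>0\<close> initially.
\<close>

section \<open>Gronwall estimate and uniqueness for Lipschitz vector fields\<close>

text \<open>The squared norm is used because, unlike the norm, it is differentiable even where
  \<open>y\<close> vanishes. Cauchy-Schwarz bounds its derivative by \<open>2 * L\<close> times the
  squared norm, which the factor \<open>exp (- 2 * L * s)\<close> compensates.\<close>

lemma zero_if_derivative_bounded_by_norm:
  fixes y :: "real \<Rightarrow> 'a::real_inner"
  assumes deriv: "\<And>t. t \<in> {a..b} \<Longrightarrow> (y has_vector_derivative y' t) (at t within {a..b})"
    and bound: "\<And>t. t \<in> {a..b} \<Longrightarrow> norm (y' t) \<le> L * norm (y t)"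
    and zero: "y a = 0" and t: "t \<in> {a..b}"
  shows "y t = 0"
proof -
  define u where "u = (\<lambda>s. exp (- 2 * L * s) * (y s \<bullet> y s))"
  have cont: "continuous_on {a..b} y"
    using deriv by (meson continuous_on_eq_continuous_within has_vector_derivative_continuous)
  have "u t \<le> u a"
  \<comment> \<open>The sign of the derivative is needed only at interior points, where the
    derivative within \<open>{a..b}\<close> is the ordinary one; at the end points continuity
    suffices.\<close>
  proof (rule DERIV_nonpos_imp_decreasing_open[where f = u])
    show "a \<le> t" using t by simp
    show "continuous_on {a..t} u"
      unfolding u_def using t by (intro continuous_intros continuous_on_subset[OF cont]) auto
    fix s assume s: "a < s" "s < t"
    then have sab: "s \<in> {a..b}" and at: "at s within {a..b} = at s"
      using t by (auto simp: at_within_Icc_at)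
    have "(y has_derivative (\<lambda>h. h *\<^sub>R y' s)) (at s)"
      using deriv[OF sab] by (simp add: at has_vector_derivative_def)
    from has_derivative_inner[OF this this]
    have dy: "((\<lambda>s. y s \<bullet> y s) has_real_derivative 2 * (y s \<bullet> y' s)) (at s)"
      by (rule has_derivative_imp_has_field_derivative) (simp add: inner_commute)
    have du: "(u has_real_derivative 2 * exp (- 2 * L * s) * (y s \<bullet> y' s - L * (y s \<bullet> y s))) (at s)"
      unfolding u_def
      by (rule DERIV_cong[OF DERIV_mult[OF DERIV_fun_exp[OF DERIV_cmult[OF DERIV_ident]] dy]])
        (simp add: algebra_simps)
    have "y s \<bullet> y' s \<le> norm (y s) * norm (y' s)" by (rule norm_cauchy_schwarz)
    also have "\<dots> \<le> norm (y s) * (L * norm (y s))"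
      by (intro mult_left_mono bound sab) simp
    finally have "y s \<bullet> y' s - L * (y s \<bullet> y s) \<le> 0"
      by (simp add: dot_square_norm power2_eq_square algebra_simps)
    with du show "\<exists>d. (u has_real_derivative d) (at s) \<and> d \<le> 0"
      by (intro exI[of _ "2 * exp (- 2 * L * s) * (y s \<bullet> y' s - L * (y s \<bullet> y s))"] conjI)
        (auto intro: mult_nonneg_nonpos)
  qed
  also have "u a = 0" by (simp add: u_def zero)
  finally have "y t \<bullet> y t \<le> 0"
    by (simp add: u_def mult_le_0_iff not_le)
  then show ?thesis by (simp add: dot_square_norm)
qed

text \<open>The difference of the solutions satisfies the preceding differential inequality. The
  Lipschitz bound is applied only to the pair \<open>y t\<close>, \<open>z t\<close> at a common
  time, so any \<open>K\<close> containing both trajectories will do.\<close>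

lemma ODE_unique_on_interval:
  fixes y z :: "real \<Rightarrow> 'a::real_inner"
  assumes y: "\<And>t. t \<in> {a..b} \<Longrightarrow> (y has_vector_derivative f (y t)) (at t within {a..b})"
    and z: "\<And>t. t \<in> {a..b} \<Longrightarrow> (z has_vector_derivative f (z t)) (at t within {a..b})"
    and K: "y ` {a..b} \<subseteq> K" "z ` {a..b} \<subseteq> K"
    and L: "L-lipschitz_on K f" and init: "y a = z a" and t: "t \<in> {a..b}"
  shows "y t = z t"
proof -
  have "y t - z t = 0"
  proof (rule zero_if_derivative_bounded_by_norm[where y = "\<lambda>t. y t - z t" and L = L])
    show "((\<lambda>t. y t - z t) has_vector_derivative f (y t) - f (z t)) (at t within {a..b})"
      if "t \<in> {a..b}" for t
      using y[OF that] z[OF that] by (rule has_vector_derivative_diff)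
    show "norm (f (y t) - f (z t)) \<le> L * norm (y t - z t)" if "t \<in> {a..b}" for t
      using K that by (intro lipschitz_on_normD[OF L]) auto
  qed (use init t in auto)
  then show ?thesis by simp
qed

section \<open>Calculus of Lipschitz functions on compact sets\<close>

lemma lipschitz_on_scaleR_bounded:
  fixes g :: "'a::metric_space \<Rightarrow> 'b::real_normed_vector"
  assumes f: "C-lipschitz_on U f" "\<And>x. x \<in> U \<Longrightarrow> \<bar>f x\<bar> \<le> A"
    and g: "D-lipschitz_on U g" "\<And>x. x \<in> U \<Longrightarrow> norm (g x) \<le> B"
    and "0 \<le> A" "0 \<le> B"
  shows "(A * D + B * C)-lipschitz_on U (\<lambda>x. f x *\<^sub>R g x)"
proof (rule lipschitz_onI)
  fix x y assume xy: "x \<in> U" "y \<in> U"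
  \<comment> \<open>The mixed term \<open>f x *\<^sub>R g y\<close> is subtracted and added, so that
    each summand contains only one increment.\<close>
  have "dist (f x *\<^sub>R g x) (f y *\<^sub>R g y) = norm (f x *\<^sub>R (g x - g y) + (f x - f y) *\<^sub>R g y)"
    by (simp add: dist_norm algebra_simps)
  also have "\<dots> \<le> \<bar>f x\<bar> * dist (g x) (g y) + dist (f x) (f y) * norm (g y)"
    by (rule order_trans[OF norm_triangle_ineq]) (simp add: dist_norm)
  also have "\<dots> \<le> A * (D * dist x y) + (C * dist x y) * B"
    using assms xy lipschitz_onD[OF f(1) xy] lipschitz_onD[OF g(1) xy] lipschitz_on_nonneg[OF f(1)]
    by (intro add_mono mult_mono) auto
  finally show "dist (f x *\<^sub>R g x) (f y *\<^sub>R g y) \<le> (A * D + B * C) * dist x y"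
    by (simp add: algebra_simps)
qed (use assms lipschitz_on_nonneg[OF f(1)] lipschitz_on_nonneg[OF g(1)] in auto)

text \<open>Lipschitz functions are continuous, so compactness supplies the sup bounds that the
  product estimate requires.\<close>

lemma lipschitz_on_scaleR_compact:
  fixes g :: "'a::metric_space \<Rightarrow> 'b::real_normed_vector"
  assumes "compact K" "\<exists>C. C-lipschitz_on K f" "\<exists>D. D-lipschitz_on K g"
  shows "\<exists>L. L-lipschitz_on K (\<lambda>x. f x *\<^sub>R g x)"
proof -
  from assms obtain C D where C: "C-lipschitz_on K f" and D: "D-lipschitz_on K g" by blast
  from C D assms(1) have "bounded (f ` K)" "bounded (g ` K)"
    by (auto intro!: compact_imp_bounded compact_continuous_image lipschitz_on_continuous_on)
  then obtain A B where "A > 0" "B > 0" "\<forall>x\<in>K. \<bar>f x\<bar> \<le> A" "\<forall>x\<in>K. norm (g x) \<le> B"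
    by (auto simp: bounded_pos)
  with lipschitz_on_scaleR_bounded[OF C _ D, of A B] show ?thesis by auto
qed

text \<open>This and the following rules hide the constants behind an existential, so that they
  chain by \<open>intro\<close> along the structure of a term.\<close>

lemma ex_lipschitz_on_constant: "\<exists>L. L-lipschitz_on U (\<lambda>x. c)"
  using lipschitz_on_constant by (rule exI)

lemma ex_lipschitz_on_add:
  fixes f g :: "'a::metric_space \<Rightarrow> 'b::real_normed_vector"
  shows "\<exists>C. C-lipschitz_on U f \<Longrightarrow> \<exists>D. D-lipschitz_on U g \<Longrightarrow> \<exists>L. L-lipschitz_on U (\<lambda>x. f x + g x)"
  by (blast intro: lipschitz_on_add)

lemma ex_lipschitz_on_diff:
  fixes f g :: "'a::metric_space \<Rightarrow> 'b::real_normed_vector"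
  shows "\<exists>C. C-lipschitz_on U f \<Longrightarrow> \<exists>D. D-lipschitz_on U g \<Longrightarrow> \<exists>L. L-lipschitz_on U (\<lambda>x. f x - g x)"
  by (blast intro: lipschitz_on_diff)

lemma ex_lipschitz_on_sum:
  fixes f :: "'i \<Rightarrow> 'a::metric_space \<Rightarrow> 'b::real_normed_vector"
  assumes "\<And>i. i \<in> I \<Longrightarrow> \<exists>C. C-lipschitz_on U (f i)"
  shows "\<exists>L. L-lipschitz_on U (\<lambda>x. \<Sum>i\<in>I. f i x)"
  using assms
proof (induction I rule: infinite_finite_induct)
  case (insert i I)
  then show ?case by (simp add: ex_lipschitz_on_add)
qed (simp_all add: ex_lipschitz_on_constant)

lemma ex_lipschitz_on_linear:
  "bounded_linear f \<Longrightarrow> \<exists>L. L-lipschitz_on U f"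
  by (erule bounded_linear.lipschitz_boundE) (rule exI)

lemma ex_lipschitz_on_norm:
  fixes f :: "'a::metric_space \<Rightarrow> 'b::real_normed_vector"
  assumes "\<exists>C. C-lipschitz_on U f"
  shows "\<exists>L. L-lipschitz_on U (\<lambda>x. norm (f x))"
proof -
  from assms obtain C where C: "C-lipschitz_on U f" by blast
  have "C-lipschitz_on U (\<lambda>x. norm (f x))"
  proof (rule lipschitz_onI)
    show "dist (norm (f x)) (norm (f y)) \<le> C * dist x y" if "x \<in> U" "y \<in> U" for x y
      using norm_triangle_ineq3[of "f x" "f y"] lipschitz_onD[OF C that] by (simp add: dist_norm)
  qed (rule lipschitz_on_nonneg[OF C])
  then show ?thesis by blast
qed

text \<open>From 1/u - 1/v = (v - u)/(uv) and uv at least \<open>c\<^sup>2\<close>.\<close>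

lemma ex_lipschitz_on_inverse:
  fixes f :: "'a::metric_space \<Rightarrow> real"
  assumes "\<exists>C. C-lipschitz_on U f" and "c > 0" and lower: "\<And>x. x \<in> U \<Longrightarrow> c \<le> f x"
  shows "\<exists>L. L-lipschitz_on U (\<lambda>x. inverse (f x))"
proof -
  from assms obtain C where C: "C-lipschitz_on U f" by blast
  have "(C / c\<^sup>2)-lipschitz_on U (\<lambda>x. inverse (f x))"
  proof (rule lipschitz_onI)
    fix x y assume xy: "x \<in> U" "y \<in> U"
    have pos: "f x > 0" "f y > 0" using lower[OF xy(1)] lower[OF xy(2)] \<open>c > 0\<close> by linarith+
    have prod: "c\<^sup>2 \<le> f x * f y"
      unfolding power2_eq_square using lower[OF xy(1)] lower[OF xy(2)] \<open>c > 0\<close>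
      by (intro mult_mono) auto
    have "dist (inverse (f x)) (inverse (f y)) = dist (f x) (f y) / (f x * f y)"
      using pos by (simp add: dist_real_def inverse_diff_inverse abs_mult abs_minus_commute divide_simps)
    also have "\<dots> \<le> (C * dist x y) / c\<^sup>2"
      using \<open>c > 0\<close> prod lipschitz_onD[OF C xy]
      by (intro frac_le) (auto simp: lipschitz_on_nonneg[OF C])
    finally show "dist (inverse (f x)) (inverse (f y)) \<le> C / c\<^sup>2 * dist x y" by simp
  qed (use \<open>c > 0\<close> lipschitz_on_nonneg[OF C] in simp)
  then show ?thesis by blast
qed

text \<open>The outer function needs a constant only on the image of \<open>K\<close>, which is
  again compact. This admits functions such as \<sigma> and its derivative, for which constants are
  available on compact sets only.\<close>

lemma ex_lipschitz_on_compose_compact: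
  assumes "compact K" "\<exists>C. C-lipschitz_on K f" "\<And>S. compact S \<Longrightarrow> \<exists>D. D-lipschitz_on S g"
  shows "\<exists>L. L-lipschitz_on K (\<lambda>x. g (f x))"
proof -
  from assms(2) obtain C where C: "C-lipschitz_on K f" by blast
  with \<open>compact K\<close> have "compact (f ` K)"
    by (intro compact_continuous_image lipschitz_on_continuous_on)
  with assms(3) obtain D where "D-lipschitz_on (f ` K) g" by blast
  with C show ?thesis by (blast intro: lipschitz_on_compose2)
qed

lemma C1_imp_lipschitz_on_compact:
  fixes f :: "real \<Rightarrow> 'a::real_normed_vector"
  assumes "f C1_differentiable_on UNIV" "compact S"
  shows "\<exists>L. L-lipschitz_on S f"
proof -
  from assms(1) obtain D
    where D: "\<And>x. (f has_vector_derivative D x) (at x)" and cont: "continuous_on UNIV D"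
    by (auto simp: C1_differentiable_on_def)
  \<comment> \<open>The mean value estimate requires a convex domain, so \<open>S\<close> is
    enclosed in an interval.\<close>
  obtain R where R: "S \<subseteq> {-R..R}"
    using compact_imp_bounded[OF \<open>compact S\<close>] by (force simp: bounded_iff abs_le_iff)
  have "bounded (D ` {-R..R})"
    by (intro compact_imp_bounded compact_continuous_image continuous_on_subset[OF cont]) auto
  then obtain B where B: "B > 0" "\<forall>x\<in>{-R..R}. norm (D x) \<le> B" by (auto simp: bounded_pos)
  have "B-lipschitz_on {-R..R} f"
  proof (rule bounded_derivative_imp_lipschitz)
    show "(f has_derivative (\<lambda>h. h *\<^sub>R D x)) (at x within {-R..R})" for x
      using D[of x] by (simp add: has_vector_derivative_def has_derivative_at_withinI)
    show "onorm (\<lambda>h. h *\<^sub>R D x) \<le> B" if "x \<in> {-R..R}" for x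
      using B that by (intro onorm_bound) (auto simp: mult.commute[of B] intro!: mult_left_mono)
  qed (use B in auto)
  with R show ?thesis by (blast intro: lipschitz_on_subset)
qed

lemma local_lipschitz_imp_lipschitz_on_compact:
  assumes "local_lipschitz (UNIV :: real set) UNIV (\<lambda>_. f)" "compact S"
  shows "\<exists>L. L-lipschitz_on S f"
proof -
  \<comment> \<open>A uniform constant comes from compactness in both arguments, so the dummy
    parameter is confined to the compact set \<open>{0}\<close>.\<close>
  have "local_lipschitz {0 :: real} S (\<lambda>_. f)"
    using assms(1) by (rule local_lipschitz_subset) auto
  then show ?thesis
    using local_lipschitz_compact_implies_lipschitz[OF _ assms(2), of "{0}" "\<lambda>_. f"] by auto
qed

section \<open>The system as an autonomous ODE on a product space\<close>

text \<open>The form is chosen for the Lipschitz calculus: every product, even of reals, is a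
  \<open>*\<^sub>R\<close>, the quotient is a product with an inverse, and the angular part is a
  finite sum over the basis vectors \<open>axis j 1\<close>.\<close>

definition drift :: "(real \<Rightarrow> real) \<Rightarrow> (3 \<Rightarrow> real^2) \<Rightarrow> (real^3) \<times> (real^2) \<Rightarrow> (real^3) \<times> (real^2)" where
  "drift \<sigma> x = (\<lambda>(\<alpha>, a).
     (\<Sum>j\<in>UNIV. (deriv \<sigma> (misorientation \<alpha> j) *\<^sub>R norm (x j - a)
                   - deriv \<sigma> (misorientation \<alpha> (j + 1)) *\<^sub>R norm (x (j + 1) - a)) *\<^sub>R axis j 1,
      \<Sum>j\<in>UNIV. \<sigma> (misorientation \<alpha> j) *\<^sub>R inverse (norm (x j - a)) *\<^sub>R (x j - a)))"

lemma classical_solution_drift: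
  assumes "classical_solution \<sigma> x \<alpha>\<^sub>0 a\<^sub>0 T \<alpha> a" "t \<in> {0..T}"
  shows "((\<lambda>t. (\<alpha> t, a t)) has_vector_derivative drift \<sigma> x (\<alpha> t, a t)) (at t within {0..T})"
proof -
  let ?d = "\<lambda>j. deriv \<sigma> (misorientation (\<alpha> t) j) * norm (x j - a t)
                 - deriv \<sigma> (misorientation (\<alpha> t) (j + 1)) * norm (x (j + 1) - a t)"
  have "((\<lambda>t. \<alpha> t $ j) has_vector_derivative ?d j) (at t within {0..T})" for j
    using assms by (simp add: classical_solution_def Let_def has_real_derivative_iff_has_vector_derivative)
  then have "((\<lambda>t. \<Sum>j\<in>UNIV. \<alpha> t $ j *\<^sub>R axis j (1::real)) has_vector_derivative
      (\<Sum>j\<in>UNIV. ?d j *\<^sub>R axis j 1)) (at t within {0..T})"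
    by (intro has_vector_derivative_sum bounded_linear.has_vector_derivative[OF bounded_linear_scaleR_left])
  \<comment> \<open>Expansion in the standard basis turns the three scalar equations into one vector
    equation.\<close>
  moreover have "(\<lambda>t. \<Sum>j\<in>UNIV. \<alpha> t $ j *\<^sub>R axis j (1::real)) = \<alpha>"
    using basis_expansion[where 'a = real and 'n = 3] by (simp add: scalar_mult_eq_scaleR)
  ultimately have "(\<alpha> has_vector_derivative (\<Sum>j\<in>UNIV. ?d j *\<^sub>R axis j 1)) (at t within {0..T})"
    by (simp only:)
  moreover have "(a has_vector_derivative
      (\<Sum>j\<in>UNIV. \<sigma> (misorientation (\<alpha> t) j) *\<^sub>R inverse (norm (x j - a t)) *\<^sub>R (x j - a t)))
      (at t within {0..T})"
    using assms by (simp add: classical_solution_def Let_def)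
  ultimately show ?thesis
    by (simp add: drift_def has_vector_derivative_Pair)
qed

text \<open>The estimate is assembled factor by factor instead of from a derivative bound on the
  field: \<open>K\<close> may fail to be convex and \<open>deriv \<sigma>\<close> may fail to be
  differentiable.\<close>

lemma drift_lipschitz_on:
  assumes \<sigma>: "surface_tension \<sigma>" and K: "compact K" and "c > 0"
    and lower: "\<And>\<alpha> a j. (\<alpha>, a) \<in> K \<Longrightarrow> c \<le> norm (x j - a)"
  shows "\<exists>L. L-lipschitz_on K (drift \<sigma> x)"
proof -
  have mis: "\<exists>C. C-lipschitz_on K (\<lambda>z. misorientation (fst z) j)" for j
    unfolding misorientation_def
    by (intro ex_lipschitz_on_linear bounded_linear_intros bounded_linear_compose[OF bounded_linear_vec_nth])
  have b: "\<exists>C. C-lipschitz_on K (\<lambda>z. x j - snd z)" for j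
    by (rule ex_lipschitz_on_diff[OF ex_lipschitz_on_constant ex_lipschitz_on_linear[OF bounded_linear_snd]])
  have \<sigma>': "\<exists>C. C-lipschitz_on K (\<lambda>z. deriv \<sigma> (misorientation (fst z) j))" for j
    using \<sigma> by (intro ex_lipschitz_on_compose_compact[OF K mis] local_lipschitz_imp_lipschitz_on_compact)
      (auto simp: surface_tension_def)
  have s: "\<exists>C. C-lipschitz_on K (\<lambda>z. \<sigma> (misorientation (fst z) j))" for j
    using \<sigma> by (intro ex_lipschitz_on_compose_compact[OF K mis] C1_imp_lipschitz_on_compact)
      (auto simp: surface_tension_def)
  \<comment> \<open>The only singular factor; the lower bound \<open>c\<close> enters here.\<close>
  have inv: "\<exists>C. C-lipschitz_on K (\<lambda>z. inverse (norm (x j - snd z)))" for j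
    using lower by (intro ex_lipschitz_on_inverse[OF ex_lipschitz_on_norm[OF b] \<open>c > 0\<close>]) auto
  have "\<exists>C. C-lipschitz_on K (\<lambda>z. \<Sum>j\<in>UNIV.
      (deriv \<sigma> (misorientation (fst z) j) *\<^sub>R norm (x j - snd z)
        - deriv \<sigma> (misorientation (fst z) (j + 1)) *\<^sub>R norm (x (j + 1) - snd z)) *\<^sub>R axis j (1::real))"
    by (intro ex_lipschitz_on_sum lipschitz_on_scaleR_compact[OF K] ex_lipschitz_on_diff
        \<sigma>' ex_lipschitz_on_norm b ex_lipschitz_on_constant)
  moreover have "\<exists>C. C-lipschitz_on K (\<lambda>z. \<Sum>j\<in>UNIV.
      \<sigma> (misorientation (fst z) j) *\<^sub>R inverse (norm (x j - snd z)) *\<^sub>R (x j - snd z))"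
    by (intro ex_lipschitz_on_sum lipschitz_on_scaleR_compact[OF K] s inv b)
  ultimately show ?thesis
    unfolding drift_def case_prod_beta by (elim exE) (rule exI, rule lipschitz_on_Pair)
qed

theorem theorem6p3:
  fixes \<sigma> :: "real \<Rightarrow> real"
    and x :: "3 \<Rightarrow> real^2"
    and \<alpha>\<^sub>0 :: "real^3" and a\<^sub>0 :: "real^2"
    and T :: real
    and \<alpha>\<^sub>1 \<alpha>\<^sub>2 :: "real \<Rightarrow> real^3"
    and a\<^sub>1 a\<^sub>2 :: "real \<Rightarrow> real^2"
  assumes "surface_tension \<sigma>"
    and "T > 0"
    and "classical_solution \<sigma> x \<alpha>\<^sub>0 a\<^sub>0 T \<alpha>\<^sub>1 a\<^sub>1"
    and "classical_solution \<sigma> x \<alpha>\<^sub>0 a\<^sub>0 T \<alpha>\<^sub>2 a\<^sub>2"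
    and "\<exists>c>0. \<forall>t\<in>{0..T}. \<forall>j. norm (x j - a\<^sub>1 t) \<ge> c \<and> norm (x j - a\<^sub>2 t) \<ge> c"
  shows "\<forall>t\<in>{0..T}. (\<alpha>\<^sub>1 t, a\<^sub>1 t) = (\<alpha>\<^sub>2 t, a\<^sub>2 t)"
proof
  fix t assume t: "t \<in> {0..T}"
  let ?y = "\<lambda>t. (\<alpha>\<^sub>1 t, a\<^sub>1 t)" and ?z = "\<lambda>t. (\<alpha>\<^sub>2 t, a\<^sub>2 t)"
  \<comment> \<open>Exactly the traces of the two trajectories, so the bound \<open>c\<close>
    carries over to \<open>K\<close> directly; a convex hull or a ball around them could contain
    points with \<open>a = x j\<close>.\<close>
  define K where "K = ?y ` {0..T} \<union> ?z ` {0..T}"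
  note y = classical_solution_drift[OF assms(3)] and z = classical_solution_drift[OF assms(4)]
  have "continuous_on {0..T} ?y" "continuous_on {0..T} ?z"
    using has_vector_derivative_continuous[OF y] has_vector_derivative_continuous[OF z]
    by (auto simp: continuous_on_eq_continuous_within)
  then have "compact K"
    unfolding K_def by (intro compact_Un compact_continuous_image) auto
  moreover obtain c where "c > 0"
    and c: "\<forall>t\<in>{0..T}. \<forall>j. norm (x j - a\<^sub>1 t) \<ge> c \<and> norm (x j - a\<^sub>2 t) \<ge> c"
    using assms(5) by blast
  moreover have "c \<le> norm (x j - a)" if "(\<alpha>, a) \<in> K" for \<alpha> a j
    using that c by (auto simp: K_def)
  ultimately obtain L where "L-lipschitz_on K (drift \<sigma> x)"
    using drift_lipschitz_on[OF assms(1)] by blast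
  moreover have "?y 0 = ?z 0"
    using assms(3,4) by (simp add: classical_solution_def)
  ultimately show "?y t = ?z t"
    using t by - (rule ODE_unique_on_interval[OF y z, where K = K], simp_all add: K_def)
qed

end
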